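(* Let $\mathcal{T}$ be the density topology on $\mathbf{R}$ and let $A \subseteq \mathbf{R}$ be an arbitrary subset, equipped with the subspace topology inherited from $(\mathbf{R},\mathcal{T})$. The following conditions are equivalent: (1) $A$ is a nullset (i.e. $A$ has Lebesgue measure zero). (2) The space $A$ is semi-stratifiable.
   Context: Density topology: let $m$ denote Lebesgue measure. A Lebesgue measurable set $E \subseteq \mathbf{R}$ has density $d$ at $x \in \mathbf{R}$ if $\lim_{h \to 0^+} \frac{m(E \cap [x-h,x+h])}{2h}$ exists and equals $d$. Let $\phi(E)$ be the set of $x\in\mathbf{R}$ at which $E$ has density $1$. The open sets of the density topology $\mathcal{T}$ on $\mathbf{R}$ are the measurable sets $E$ with $E \subseteq \phi(E)$. A topological space $X$ is semi-stratifiable if to each open set $U \subseteq X$ one can assign a sequence $(U_n)_{n\in\mathbf{N}}$ of closed subsets of $X$ such that $U = \bigcup_n U_n$, and $U_n \subseteq V_n$ for all $n$ whenever $U \subseteq V$ are open. *)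

theory Defs
  imports "HOL-Analysis.Analysis"
begin

definition has_density :: "real set \<Rightarrow> real \<Rightarrow> real \<Rightarrow> bool" where
  "has_density E d x \<longleftrightarrow>
     ((\<lambda>h. measure lebesgue (E \<inter> {x - h..x + h}) / (2 * h)) \<longlongrightarrow> d) (at_right 0)"

definition density_points :: "real set \<Rightarrow> real set" where
  "density_points E = {x. has_density E 1 x}"

definition density_open :: "real set \<Rightarrow> bool" where
  "density_open E \<longleftrightarrow> E \<in> sets lebesgue \<and> E \<subseteq> density_points E"

(* The constant topology is only meaningful on predicates satisfying istopology;
   this is the content of istopology_density_open below. *)
definition density_topology :: "real topology" where
  "density_topology = topology density_open"

definition semi_stratifiable :: "'a topology \<Rightarrow> bool" where
  "semi_stratifiable X \<longleftrightarrow>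
     (\<exists>F :: 'a set \<Rightarrow> nat \<Rightarrow> 'a set.
        (\<forall>U. openin X U \<longrightarrow> (\<forall>n. closedin X (F U n)) \<and> U = (\<Union>n. F U n)) \<and>
        (\<forall>U V. openin X U \<and> openin X V \<and> U \<subseteq> V \<longrightarrow> (\<forall>n. F U n \<subseteq> F V n)))"

lemma lmeasurable_Int_Icc:
  fixes E :: "real set"
  assumes "E \<in> sets lebesgue"
  shows "E \<inter> {a..b} \<in> lmeasurable"
  using fmeasurable_Int_fmeasurable[OF lmeasurable_interval(1)[of a b] assms]
  by (simp add: Int_commute)

lemma density_ratio_le_1:
  assumes "E \<in> sets lebesgue" "h > 0"
  shows "measure lebesgue (E \<inter> {x - h..x + h}) / (2 * h) \<le> 1"
proof -
  have "measure lebesgue (E \<inter> {x - h..x + h}) \<le> measure lebesgue {x - h..x + h}"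
    using assms lmeasurable_Int_Icc[OF assms(1)]
    by (intro measure_mono_fmeasurable) (auto simp: fmeasurableD)
  then show ?thesis using assms(2) by simp
qed

lemma has_density_mono:
  assumes d: "has_density E 1 x" and "E \<in> sets lebesgue" "F \<in> sets lebesgue" "E \<subseteq> F"
  shows "has_density F 1 x"
  unfolding has_density_def
proof (rule tendsto_sandwich)
  show "((\<lambda>h. measure lebesgue (E \<inter> {x - h..x + h}) / (2 * h)) \<longlongrightarrow> 1) (at_right 0)"
    using d by (simp add: has_density_def)
  show "((\<lambda>h. 1) \<longlongrightarrow> (1::real)) (at_right (0::real))" by simp
  have p: "eventually (\<lambda>h. h > 0) (at_right (0::real))"
    by (simp add: eventually_at_right_less)
  show "\<forall>\<^sub>F h in at_right 0. measure lebesgue (E \<inter> {x - h..x + h}) / (2 * h)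
          \<le> measure lebesgue (F \<inter> {x - h..x + h}) / (2 * h)"
    using p
  proof eventually_elim
    case (elim h)
    have "measure lebesgue (E \<inter> {x - h..x + h}) \<le> measure lebesgue (F \<inter> {x - h..x + h})"
      using assms lmeasurable_Int_Icc
      by (intro measure_mono_fmeasurable) (auto simp: fmeasurableD)
    then show ?case using elim by (simp add: divide_right_mono)
  qed
  show "\<forall>\<^sub>F h in at_right 0. measure lebesgue (F \<inter> {x - h..x + h}) / (2 * h) \<le> 1"
    using p by eventually_elim (use assms density_ratio_le_1 in blast)
qed

lemma has_density_cong_negligible:
  assumes "E \<in> sets lebesgue" "F \<in> sets lebesgue" "negligible ((E - F) \<union> (F - E))"
  shows "has_density E d x \<longleftrightarrow> has_density F d x"
proof -
  have "measure lebesgue (F \<inter> {x - h..x + h}) = measure lebesgue (E \<inter> {x - h..x + h})" for h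
    by (rule measure_negligible_symdiff)
       (use assms lmeasurable_Int_Icc in \<open>auto intro: negligible_subset\<close>)
  then show ?thesis by (simp add: has_density_def)
qed

lemma has_density_Int:
  assumes "has_density E 1 x" "has_density F 1 x" "E \<in> sets lebesgue" "F \<in> sets lebesgue"
  shows "has_density (E \<inter> F) 1 x"
  unfolding has_density_def
proof (rule tendsto_sandwich)
  let ?r = "\<lambda>E h. measure lebesgue (E \<inter> {x - h..x + h}) / (2 * h)"
  show "((\<lambda>h. ?r E h + ?r F h - 1) \<longlongrightarrow> 1) (at_right 0)"
    using tendsto_diff[OF tendsto_add[OF assms(1,2)[unfolded has_density_def]] tendsto_const[of 1]]
    by simp
  show "((\<lambda>h. 1) \<longlongrightarrow> (1::real)) (at_right (0::real))" by simp
  have p: "eventually (\<lambda>h. h > 0) (at_right (0::real))"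
    by (simp add: eventually_at_right_less)
  show "\<forall>\<^sub>F h in at_right 0. ?r E h + ?r F h - 1 \<le> ?r (E \<inter> F) h"
    using p
  proof eventually_elim
    case (elim h)
    let ?I = "{x - h..x + h}"
    have "measure lebesgue ((E \<inter> ?I) \<union> (F \<inter> ?I)) = measure lebesgue (E \<inter> ?I)
        + measure lebesgue (F \<inter> ?I) - measure lebesgue ((E \<inter> ?I) \<inter> (F \<inter> ?I))"
      using assms lmeasurable_Int_Icc by (intro measure_Un3) auto
    moreover have "(E \<inter> ?I) \<inter> (F \<inter> ?I) = (E \<inter> F) \<inter> ?I" "(E \<inter> ?I) \<union> (F \<inter> ?I) = (E \<union> F) \<inter> ?I"
      by auto
    moreover have "measure lebesgue ((E \<union> F) \<inter> ?I) / (2 * h) \<le> 1"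
      using assms elim by (intro density_ratio_le_1) auto
    ultimately have "measure lebesgue (E \<inter> ?I) + measure lebesgue (F \<inter> ?I) - 2 * h
        \<le> measure lebesgue ((E \<inter> F) \<inter> ?I)"
      using elim by (simp add: divide_le_eq)
    then have "(measure lebesgue (E \<inter> ?I) + measure lebesgue (F \<inter> ?I) - 2 * h) / (2 * h)
        \<le> ?r (E \<inter> F) h"
      using elim by (intro divide_right_mono) auto
    then show ?case using elim by (simp add: add_divide_distrib diff_divide_distrib)
  qed
  show "\<forall>\<^sub>F h in at_right 0. ?r (E \<inter> F) h \<le> 1"
    using p by eventually_elim (use assms density_ratio_le_1 in blast)
qed

lemma countable_subfamily_almost_cover:
  fixes K :: "real set set"
  assumes K: "\<And>E. E \<in> K \<Longrightarrow> E \<in> sets lebesgue"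
  obtains C where "countable C" "C \<subseteq> K" "\<And>E. E \<in> K \<Longrightarrow> negligible (E - \<Union>C)"
proof -
  define I where "I n = {- real n..real n}" for n
  define m where "m n C = measure lebesgue (\<Union>C \<inter> I n)" for n C
  define \<C> where "\<C> = {C. countable C \<and> C \<subseteq> K}"
  have meas: "\<Union>C \<in> sets lebesgue" if "C \<in> \<C>" for C
    using that K by (auto simp: \<C>_def intro!: sets.countable_Union)
  have lm: "\<Union>C \<inter> I n \<in> lmeasurable" if "C \<in> \<C>" for C n
    using meas[OF that] by (auto simp: I_def intro: lmeasurable_Int_Icc)
  have mono: "m n C \<le> m n D" if "C \<subseteq> D" "C \<in> \<C>" "D \<in> \<C>" for n C D
    unfolding m_def using that lm
    by (intro measure_mono_fmeasurable) (auto simp: fmeasurableD)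
  have bdd: "bdd_above (m n ` \<C>)" for n
  proof (rule bdd_aboveI2)
    fix C assume "C \<in> \<C>"
    then show "m n C \<le> measure lebesgue (I n)"
      unfolding m_def using lm[of C n]
      by (intro measure_mono_fmeasurable) (auto simp: fmeasurableD I_def)
  qed
  have ne: "\<C> \<noteq> {}" by (auto simp: \<C>_def)
  have "\<exists>C. C \<in> \<C> \<and> m n C > (SUP C\<in>\<C>. m n C) - 1 / real (Suc k)" for n k
    using less_cSUP_iff[OF ne bdd, of "(SUP C\<in>\<C>. m n C) - 1 / real (Suc k)" n] by auto
  then obtain D where D: "\<And>n k. D n k \<in> \<C>"
    "\<And>n k. m n (D n k) > (SUP C\<in>\<C>. m n C) - 1 / real (Suc k)"
    by metis
  define C where "C = (\<Union>n k. D n k)"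
  have C: "C \<in> \<C>" using D(1) by (auto simp: \<C>_def C_def)
  have sup: "(SUP C\<in>\<C>. m n C) \<le> m n C" for n
  proof (rule field_le_epsilon)
    fix e :: real assume "e > 0"
    then obtain k where "1 / real (Suc k) < e" using nat_approx_posE by blast
    moreover have "m n (D n k) \<le> m n C"
      using D(1) C by (intro mono) (auto simp: C_def)
    ultimately show "(SUP C\<in>\<C>. m n C) \<le> m n C + e" using D(2)[of n k] by linarith
  qed
  have "negligible (E - \<Union>C)" if E: "E \<in> K" for E
  proof -
    have iC: "insert E C \<in> \<C>" using C E by (auto simp: \<C>_def)
    have "negligible ((E - \<Union>C) \<inter> I n)" for n
    proof -
      have "m n (insert E C) \<le> m n C"
        using cSUP_upper[OF iC bdd] sup[of n] by (rule order_trans)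
      moreover have "measure lebesgue ((\<Union>(insert E C) \<inter> I n) - (\<Union>C \<inter> I n))
          = m n (insert E C) - m n C"
        unfolding m_def using lm[OF iC] lm[OF C]
        by (intro measurable_measure_Diff) (auto simp: fmeasurableD)
      ultimately have "measure lebesgue ((\<Union>(insert E C) \<inter> I n) - (\<Union>C \<inter> I n)) = 0"
        by (metis diff_le_0_iff_le measure_le_0_iff)
      moreover have "(\<Union>(insert E C) \<inter> I n) - (\<Union>C \<inter> I n) \<in> lmeasurable"
        using lm[OF iC] lm[OF C] by (intro fmeasurable_Diff) (auto simp: fmeasurableD)
      moreover have "(\<Union>(insert E C) \<inter> I n) - (\<Union>C \<inter> I n) = (E - \<Union>C) \<inter> I n" by auto
      ultimately show ?thesis by (metis negligible_iff_measure)
    qed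
    then have "negligible (\<Union>n. (E - \<Union>C) \<inter> I n)" by (rule negligible_Union_nat)
    moreover have "(\<Union>n. (E - \<Union>C) \<inter> I n) = E - \<Union>C"
    proof -
      have "\<exists>n. x \<in> I n" for x
        using real_arch_simple[of "\<bar>x\<bar>"] by (auto simp: I_def abs_le_iff intro: minus_le_iff[THEN iffD1])
      then show ?thesis by auto
    qed
    ultimately show ?thesis by simp
  qed
  then show ?thesis using C that by (auto simp: \<C>_def)
qed

lemma istopology_density_open: "istopology density_open"
  unfolding istopology_def
proof (intro conjI allI impI)
  fix S T assume "density_open S" "density_open T"
  then show "density_open (S \<inter> T)"
    by (auto simp: density_open_def density_points_def intro!: has_density_Int)
next
  fix K assume K: "\<forall>E\<in>K. density_open E"
  then obtain C where C: "countable C" "C \<subseteq> K" "\<And>E. E \<in> K \<Longrightarrow> negligible (E - \<Union>C)"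
    by (metis countable_subfamily_almost_cover density_open_def)
  let ?V = "\<Union>C"
  have V: "?V \<in> sets lebesgue"
    using C K by (auto simp: density_open_def intro!: sets.countable_Union)
  have dV: "has_density ?V 1 x" if "x \<in> E" "E \<in> K" for x E
  proof -
    have E: "E \<in> sets lebesgue" "has_density E 1 x"
      using K that by (auto simp: density_open_def density_points_def)
    have "has_density (E \<inter> ?V) 1 x"
      using has_density_cong_negligible[of E "E \<inter> ?V" 1 x] E V C(3)[OF that(2)]
      by (auto intro: negligible_subset)
    then show ?thesis by (rule has_density_mono) (use E V in auto)
  qed
  have "negligible (\<Union>K - ?V)"
    unfolding negligible_eq_zero_density
  proof (intro ballI allI impI)
    fix x r e :: real assume x: "x \<in> \<Union>K - ?V" and r: "r > 0" and e: "e > 0"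
    have "((\<lambda>h. measure lebesgue (?V \<inter> {x - h..x + h}) / (2 * h)) \<longlongrightarrow> 1) (at_right 0)"
      using dV x by (auto simp: has_density_def)
    then have "\<forall>\<^sub>F h in at_right 0. measure lebesgue (?V \<inter> {x - h..x + h}) / (2 * h) > 1 - e"
      using e by (auto intro: order_tendstoD)
    moreover have "\<forall>\<^sub>F h in at_right 0. 0 < h \<and> h < r"
      using eventually_at_right[of "0::real" r] r eventually_at_right_real by force
    ultimately have "\<forall>\<^sub>F h in at_right 0.
        measure lebesgue (?V \<inter> {x - h..x + h}) / (2 * h) > 1 - e \<and> 0 < h \<and> h < r"
      by eventually_elim auto
    then obtain h where h: "measure lebesgue (?V \<inter> {x - h..x + h}) / (2 * h) > 1 - e" "0 < h" "h < r"
      using eventually_happens'[OF trivial_limit_at_right_real] by blast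
    let ?I = "{x - h..x + h}"
    have lm: "?V \<inter> ?I \<in> lmeasurable" by (rule lmeasurable_Int_Icc[OF V])
    have "measure lebesgue (?I - (?V \<inter> ?I)) = measure lebesgue ?I - measure lebesgue (?V \<inter> ?I)"
      using lm by (intro measurable_measure_Diff) (auto simp: fmeasurableD)
    also have "\<dots> < e * (2 * h)" using h by (simp add: field_simps)
    also have "2 * h = measure lebesgue (ball x h)"
      using h by (simp add: ball_eq_greaterThanLessThan)
    finally have "measure lebesgue (?I - (?V \<inter> ?I)) < e * measure lebesgue (ball x h)" .
    moreover have "?I - (?V \<inter> ?I) \<in> lmeasurable"
      using lm by (intro fmeasurable_Diff) (auto simp: fmeasurableD)
    moreover have "(\<Union>K - ?V) \<inter> ball x h \<subseteq> ?I - (?V \<inter> ?I)"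
      by (auto simp: dist_real_def)
    ultimately show "\<exists>d. 0 < d \<and> d \<le> r \<and> (\<exists>U. (\<Union>K - ?V) \<inter> ball x d \<subseteq> U \<and> U \<in> lmeasurable
        \<and> measure lebesgue U < e * measure lebesgue (ball x d))"
      using h by (intro exI[of _ h] conjI exI[of _ "?I - (?V \<inter> ?I)"]) auto
  qed
  then have "\<Union>K - ?V \<in> sets lebesgue" by (rule negligible_imp_sets)
  then have "?V \<union> (\<Union>K - ?V) \<in> sets lebesgue" using V by blast
  moreover have "?V \<union> (\<Union>K - ?V) = \<Union>K" using C by auto
  ultimately have U: "\<Union>K \<in> sets lebesgue" by simp
  moreover have "has_density (\<Union>K) 1 x" if "x \<in> E" "E \<in> K" for x E
    by (rule has_density_mono[OF dV[OF that]]) (use V U C in auto)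
  ultimately show "density_open (\<Union>K)"
    by (auto simp: density_open_def density_points_def)
qed

lemma openin_density_topology: "openin density_topology E \<longleftrightarrow> density_open E"
  by (simp add: density_topology_def istopology_density_open)

lemma topspace_density_topology: "topspace density_topology = UNIV"
proof -
  have "has_density UNIV 1 x" for x
    unfolding has_density_def
    by (rule tendsto_eventually, rule eventually_mono[OF eventually_at_right_less]) auto
  then have "openin density_topology UNIV"
    by (auto simp: openin_density_topology density_open_def density_points_def)
  then show ?thesis using openin_subset by blast
qed

end

(* If F witnesses semi-stratifiability of A, then A is the union over n of the sets of those x
   in A that belong to F (A - {y}) n for every y in A - {x}: if x were in none of them, witnessed
   by y n for each n, then the open set A - range y would contain x although no F (A - range y) n
   does, because F (A - range y) n is contained in F (A - {y n}) n.
   Each of these sets is relatively discrete in the density topology, hence of outer density 0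
   at each of its points, hence null.  Conversely the density topology is discrete on a null set. *)
theory Submission
  imports Defs
begin

text \<open>Densities ignore null sets, so \<open>- N\<close> has the same density as the whole line
  at every point, also at the points of \<open>N\<close>.\<close>

lemma density_open_Compl_negligible:
  assumes "negligible N"
  shows "density_open (- N)"
proof -
  have m: "- N \<in> sets lebesgue"
    using sets.compl_sets[OF negligible_imp_sets[OF assms]] by (simp add: Compl_eq_Diff_UNIV)
  have "has_density UNIV 1 x" for x
    using openin_topspace[of density_topology]
    by (auto simp: topspace_density_topology openin_density_topology density_open_def
        density_points_def)
  then have "has_density (- N) 1 x" for x
    using has_density_cong_negligible[of "- N" UNIV 1 x] m assms by simp
  with m show ?thesis
    by (auto simp: density_open_def density_points_def)
qed

text \<open>Close to \<open>x\<close>, all of \<open>D\<close> except \<open>x\<close> avoids a set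
  of density 1 at \<open>x\<close>. Measurability of \<open>D\<close> is not known in advance, so
  the proof bounds measurable covers of \<open>D\<close> in small balls.\<close>

lemma negligible_relatively_density_discrete:
  assumes "\<And>y. y \<in> D \<Longrightarrow> \<exists>V. density_open V \<and> y \<in> V \<and> V \<inter> D \<subseteq> {y}"
  shows "negligible D"
  unfolding negligible_eq_zero_density
proof (intro ballI allI impI)
  fix x r e :: real assume x: "x \<in> D" and r: "r > 0" and e: "e > 0"
  obtain V where V: "V \<in> sets lebesgue" "has_density V 1 x" "V \<inter> D \<subseteq> {x}"
    using assms[OF x] by (auto simp: density_open_def density_points_def)
  have "\<forall>\<^sub>F h in at_right 0. measure lebesgue (V \<inter> {x - h..x + h}) / (2 * h) > 1 - e"
    using V(2) e unfolding has_density_def by (auto intro: order_tendstoD)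
  then have "\<forall>\<^sub>F h in at_right 0.
      measure lebesgue (V \<inter> {x - h..x + h}) / (2 * h) > 1 - e \<and> h \<in> {0<..<r}"
    using eventually_at_right_real[OF r] by (rule eventually_conj)
  then obtain h where h: "measure lebesgue (V \<inter> {x - h..x + h}) / (2 * h) > 1 - e" "0 < h" "h < r"
    using eventually_happens'[OF trivial_limit_at_right_real] by fastforce
  let ?I = "{x - h..x + h}"
  \<comment> \<open>The centre \<open>x\<close> lies in \<open>D\<close> and possibly in
    \<open>V\<close>, so it is put back by hand; a single point adds no measure.\<close>
  let ?U = "insert x (?I - (V \<inter> ?I))"
  have lm: "V \<inter> ?I \<in> lmeasurable" by (rule lmeasurable_Int_Icc[OF V(1)])
  then have lm': "?I - (V \<inter> ?I) \<in> lmeasurable"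
    by (intro fmeasurable_Diff) (auto simp: fmeasurableD)
  have U: "?U \<in> lmeasurable"
    using fmeasurable.Un[OF lmeasurable_cbox(1)[of x x] lm'] by simp
  have "measure lebesgue ?U = measure lebesgue (?I - (V \<inter> ?I))"
    by (rule measure_negligible_symdiff[OF lm'])
       (auto intro: negligible_subset[OF negligible_sing[of x]])
  also have "\<dots> = measure lebesgue ?I - measure lebesgue (V \<inter> ?I)"
    using lm by (intro measurable_measure_Diff) (auto simp: fmeasurableD)
  also have "\<dots> < e * (2 * h)" using h by (simp add: field_simps)
  also have "2 * h = measure lebesgue (ball x h)"
    using h by (simp add: ball_eq_greaterThanLessThan)
  finally have "measure lebesgue ?U < e * measure lebesgue (ball x h)" .
  moreover have "D \<inter> ball x h \<subseteq> ?U"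
    using V(3) by (auto simp: dist_real_def)
  ultimately show "\<exists>d>0. d \<le> r \<and> (\<exists>U. D \<inter> ball x d \<subseteq> U \<and> U \<in> lmeasurable
      \<and> measure lebesgue U < e * measure lebesgue (ball x d))"
    using h U by (intro exI[of _ h] conjI exI[of _ ?U]) auto
qed

text \<open>Countable sets are null. Used both for one removed point and for the range of a
  sequence.\<close>

lemma openin_subtopology_Diff_countable:
  assumes "countable C"
  shows "openin (subtopology density_topology A) (A - C)"
  using density_open_Compl_negligible[OF negligible_iff_null_sets[THEN iffD2]]
    null_sets_completionI[OF countable_imp_null_set_lborel[OF assms]]
  by (auto simp: openin_subtopology openin_density_topology)

text \<open>Every subset is also closed, so the constant sequence with value \<open>U\<close>
  serves.\<close>

lemma semi_stratifiable_discrete: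
  assumes "\<And>U. U \<subseteq> topspace X \<Longrightarrow> openin X U"
  shows "semi_stratifiable X"
  unfolding semi_stratifiable_def
  by (rule exI[of _ "\<lambda>U n. U"]) (auto simp: closedin_def openin_subset intro: assms)

lemma semi_stratifiable_subtopology_negligible:
  assumes "negligible A"
  shows "semi_stratifiable (subtopology density_topology A)"
proof (rule semi_stratifiable_discrete)
  fix U assume "U \<subseteq> topspace (subtopology density_topology A)"
  \<comment> \<open>\<open>U\<close> is the trace on \<open>A\<close> of the complement of a null
    set.\<close>
  then have "U = - (A - U) \<inter> A" by (auto simp: topspace_density_topology)
  moreover have "density_open (- (A - U))"
    by (rule density_open_Compl_negligible) (rule negligible_subset[OF assms], blast)
  ultimately show "openin (subtopology density_topology A) U"
    by (auto simp: openin_subtopology openin_density_topology)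
qed

lemma negligible_semi_stratifiable_subtopology:
  assumes "semi_stratifiable (subtopology density_topology A)"
  shows "negligible A"
proof -
  let ?X = "subtopology density_topology A"
  obtain F where closed: "\<And>U n. openin ?X U \<Longrightarrow> closedin ?X (F U n)"
    and Un: "\<And>U. openin ?X U \<Longrightarrow> U = (\<Union>n::nat. F U n)"
    and mono: "\<And>U V n. openin ?X U \<Longrightarrow> openin ?X V \<Longrightarrow> U \<subseteq> V \<Longrightarrow> F U n \<subseteq> F V n"
    using assms unfolding semi_stratifiable_def by metis
  define D where "D n = {x \<in> A. \<forall>y \<in> A - {x}. x \<in> F (A - {y}) n}" for n
  have op: "openin ?X (A - {y})" for y
    by (simp add: openin_subtopology_Diff_countable)
  have "\<exists>n. x \<in> D n" if x: "x \<in> A" for x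
  proof (rule ccontr)
    assume "\<nexists>n. x \<in> D n"
    then obtain y where y: "\<And>n. y n \<in> A - {x}" "\<And>n. x \<notin> F (A - {y n}) n"
      using x unfolding D_def mem_Collect_eq by metis
    have opU: "openin ?X (A - range y)"
      by (simp add: openin_subtopology_Diff_countable)
    have "x \<in> A - range y" using x y(1) by auto
    then obtain m where "x \<in> F (A - range y) m" using Un[OF opU] by blast
    then have "x \<in> F (A - {y m}) m" using mono[OF opU op[of "y m"], of m] by auto
    with y(2) show False by blast
  qed
  then have "A = (\<Union>n. D n)" by (auto simp: D_def)
  moreover have "negligible (D n)" for n
  proof (rule negligible_relatively_density_discrete)
    fix y assume y: "y \<in> D n"
    \<comment> \<open>\<open>V\<close> cuts out of \<open>A\<close> the complement of a closed set
      that misses \<open>y\<close>, hence a neighbourhood of \<open>y\<close>.\<close>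
    obtain V where V: "density_open V" "A - F (A - {y}) n = V \<inter> A"
      using closed[OF op, of y n]
      by (auto simp: closedin_def openin_subtopology openin_density_topology
          topspace_density_topology)
    have "y \<notin> F (A - {y}) n" using Un[OF op[of y]] by blast
    then have "y \<in> V" using V y by (auto simp: D_def)
    \<comment> \<open>A point of \<open>D n\<close> other than \<open>y\<close> lies in
      \<open>F (A - {y}) n\<close> by the choice of \<open>D n\<close>, hence outside
      \<open>V\<close>.\<close>
    moreover have "V \<inter> D n \<subseteq> {y}"
      using V y by (auto simp: D_def)
    ultimately show "\<exists>V. density_open V \<and> y \<in> V \<and> V \<inter> D n \<subseteq> {y}"
      using V by blast
  qed
  ultimately show ?thesis by (metis negligible_Union_nat)
qed

theorem theorem2p1:
  fixes A :: "real set"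
  shows "A \<in> null_sets lebesgue \<longleftrightarrow> semi_stratifiable (subtopology density_topology A)"
  using semi_stratifiable_subtopology_negligible negligible_semi_stratifiable_subtopology
  by (auto simp: negligible_iff_null_sets)

end
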